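(* Let $(R,\mathfrak{m},K)$ be a local Artinian commutative ring, let $n\ge 1$, and let $C\subseteq R^n$ be a nonzero $R$-code. Then $$d_H(C)\leq n-\frac{\lambda(C)}{\lambda(R)}+1 \qquad\text{and}\qquad d_H(C)\leq n-\frac{\operatorname{type}(C)}{\operatorname{type}(R)}+1.$$
   Context: All rings are commutative with unity. $(R,\mathfrak{m},K)$ is a local Artinian ring with maximal ideal $\mathfrak{m}$ and residue field $K=R/\mathfrak{m}$. An $R$-code of length $n$ is an $R$-submodule $C\subseteq R^n$. $\lambda(M)$ denotes the length of an $R$-module $M$. The socle of a finitely generated $R$-module $M$ is $\operatorname{soc}(M)=\{v\in M : \mathfrak{m}v=0\}$, and $\operatorname{type}(M)=\dim_K\operatorname{soc}(M)$. For $C\ne 0$, $d_H(C)=\min\{w_H(v) : v\in C\setminus\{0\}\}$, where $w_H(v)=|\{i : v_i\neq 0\}|$ is the Hamming weight. *)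

theory Defs
  imports
    "HOL-Algebra.QuotRing"
    "HOL-Library.Extended_Nat"
    "HOL-Library.FuncSet"
    "Jordan_Normal_Form.Missing_VectorSpace"
begin

section \<open>Local Artinian rings\<close>

text \<open>The zero ring is excluded, since a maximal ideal is a proper ideal.\<close>

locale local_ring = cring R + maximalideal \<mm> R for \<mm> and R (structure) +
  assumes unique_maximal: "maximalideal J R \<Longrightarrow> J = \<mm>"

locale artinian_ring = cring R for R (structure) +
  assumes descending_chain:
    "\<lbrakk>\<And>k :: nat. ideal (I k) R; \<And>k. I (Suc k) \<subseteq> I k\<rbrakk> \<Longrightarrow> \<exists>N. \<forall>k\<ge>N. I k = I N"

locale local_artinian_ring = local_ring \<mm> R + artinian_ring R for \<mm> and R (structure)


section \<open>Modules, length, socle and type\<close>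

text \<open>The name \<open>submodule\<close> refers to the locale from the vector space library (with arguments ring,
  subset, ambient module), not to the one from \<open>HOL-Algebra.Module\<close>.\<close>

definition self_module :: "('a, 'b) ring_scheme \<Rightarrow> ('a, 'a) module"
  where "self_module R =
    \<lparr>carrier = carrier R, mult = mult R, one = one R, zero = zero R, add = add R, smult = mult R\<rparr>"

text \<open>The length may be infinite, and \<open>vectorspace.dim\<close> (in \<open>module_type\<close> below) is meaningful only in finite
  dimension. A local Artinian ring and its finitely generated modules have finite length, so for
  these modules \<open>the_enat\<close> applied to the length, and the type, are the usual natural numbers.\<close>

definition module_length :: "('a, 'b) ring_scheme \<Rightarrow> ('a, 'c, 'd) module_scheme \<Rightarrow> enat"
  where "module_length R M =
    Sup {enat l | l. \<exists>N :: nat \<Rightarrow> 'c set.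
      (\<forall>i\<le>l. submodule R (N i) M) \<and> (\<forall>i<l. N i \<subset> N (Suc i))}"

definition socle :: "'a set \<Rightarrow> ('a, 'c, 'd) module_scheme \<Rightarrow> 'c set"
  where "socle \<mm> M = {v \<in> carrier M. \<forall>r\<in>\<mm>. r \<odot>\<^bsub>M\<^esub> v = \<zero>\<^bsub>M\<^esub>}"

text \<open>The socle is annihilated by \<open>\<mm>\<close>, so the residue field acts on it. An element of
  \<open>R Quot \<mm>\<close> is a coset \<open>X\<close>, all of whose elements act on the socle in the same way; see
  \<open>socle_space_smult\<close> and \<open>vectorspace_socle_space\<close> below.\<close>

definition socle_space :: "'a set \<Rightarrow> ('a, 'c, 'd) module_scheme \<Rightarrow> ('a set, 'c) module"
  where "socle_space \<mm> M =
    \<lparr>carrier = socle \<mm> M, mult = mult M, one = one M, zero = zero M, add = add M,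
     smult = (\<lambda>X v. the_elem ((\<lambda>r. r \<odot>\<^bsub>M\<^esub> v) ` X))\<rparr>"

definition module_type ::
    "'a set \<Rightarrow> ('a, 'b) ring_scheme \<Rightarrow> ('a, 'c, 'd) module_scheme \<Rightarrow> nat"
  where "module_type \<mm> R M = vectorspace.dim (R Quot \<mm>) (socle_space \<mm> M)"


section \<open>Codes\<close>

text \<open>\<open>R\<^sup>n\<close> is the library's module of functions from \<open>{..<n}\<close> to \<open>R\<close> (extensional, so that
  equality is equality of coordinates).\<close>

abbreviation power_module :: "('a, 'b) ring_scheme \<Rightarrow> nat \<Rightarrow> ('a, nat \<Rightarrow> 'a) module"
  where "power_module R n \<equiv> ring.func_space R {..<n}"

abbreviation is_code :: "('a, 'b) ring_scheme \<Rightarrow> nat \<Rightarrow> (nat \<Rightarrow> 'a) set \<Rightarrow> bool"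
  where "is_code R n C \<equiv> submodule R C (power_module R n)"

abbreviation code_as_module ::
    "('a, 'b) ring_scheme \<Rightarrow> nat \<Rightarrow> (nat \<Rightarrow> 'a) set \<Rightarrow> ('a, nat \<Rightarrow> 'a) module"
  where "code_as_module R n C \<equiv> (power_module R n)\<lparr>carrier := C\<rparr>"

definition hamming_weight :: "('a, 'b) ring_scheme \<Rightarrow> nat \<Rightarrow> (nat \<Rightarrow> 'a) \<Rightarrow> nat"
  where "hamming_weight R n v = card {i. i < n \<and> v i \<noteq> \<zero>\<^bsub>R\<^esub>}"

definition min_distance :: "('a, 'b) ring_scheme \<Rightarrow> nat \<Rightarrow> (nat \<Rightarrow> 'a) set \<Rightarrow> nat"
  where "min_distance R n C = Min (hamming_weight R n ` (C - {\<zero>\<^bsub>power_module R n\<^esub>}))"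


section \<open>Well-definedness\<close>

lemma (in cring) module_self_module: "module R (self_module R)"
proof (rule moduleI)
  show "abelian_group (self_module R)"
  proof (rule abelian_groupI)
    show "\<exists>y\<in>carrier (self_module R). y \<oplus>\<^bsub>self_module R\<^esub> x = \<zero>\<^bsub>self_module R\<^esub>"
      if "x \<in> carrier (self_module R)" for x
      using add.l_inv_ex[of x] that by (simp add: self_module_def)
    show "x \<oplus>\<^bsub>self_module R\<^esub> y = y \<oplus>\<^bsub>self_module R\<^esub> x"
      if "x \<in> carrier (self_module R)" "y \<in> carrier (self_module R)" for x y
      using that a_comm[of x y] by (simp add: self_module_def)
  qed (simp_all add: self_module_def a_assoc)
qed (auto simp: self_module_def l_distr r_distr m_assoc is_cring)

lemma (in module) submodule_socle:
  assumes "ideal \<mm> R"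
  shows "submodule R (socle \<mm> M) M"
proof -
  interpret ideal \<mm> R by fact
  have mem: "r \<in> carrier R" if "r \<in> \<mm>" for r
    using that by (rule a_Hcarr)
  have "r \<odot>\<^bsub>M\<^esub> (c \<odot>\<^bsub>M\<^esub> v) = \<zero>\<^bsub>M\<^esub>"
    if "r \<in> \<mm>" "c \<in> carrier R" "v \<in> socle \<mm> M" for r c v
  proof -
    have "r \<odot>\<^bsub>M\<^esub> (c \<odot>\<^bsub>M\<^esub> v) = (r \<otimes>\<^bsub>R\<^esub> c) \<odot>\<^bsub>M\<^esub> v"
      using that mem by (simp add: smult_assoc1 socle_def)
    also have "\<dots> = \<zero>\<^bsub>M\<^esub>"
      using that I_r_closed by (simp add: socle_def)
    finally show ?thesis .
  qed
  then show ?thesis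
    by (intro submodule.intro) (auto simp: socle_def module_axioms mem smult_r_distr)
qed

lemma (in module) socle_space_smult:
  assumes "ideal \<mm> R" and "v \<in> socle \<mm> M" and "r \<in> carrier R"
  shows "(\<mm> +>\<^bsub>R\<^esub> r) \<odot>\<^bsub>socle_space \<mm> M\<^esub> v = r \<odot>\<^bsub>M\<^esub> v"
proof -
  interpret ideal \<mm> R by fact
  have "s \<odot>\<^bsub>M\<^esub> v = r \<odot>\<^bsub>M\<^esub> v" if s: "s \<in> \<mm> +>\<^bsub>R\<^esub> r" for s
  proof -
    obtain h where h: "h \<in> \<mm>" "s = h \<oplus>\<^bsub>R\<^esub> r"
      using s unfolding a_r_coset_def' by blast
    have "h \<in> carrier R"
      using h(1) by (rule a_Hcarr)
    then show ?thesis
      using h assms by (simp add: smult_l_distr socle_def)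
  qed
  then have "(\<lambda>s. s \<odot>\<^bsub>M\<^esub> v) ` (\<mm> +>\<^bsub>R\<^esub> r) = (\<lambda>s. r \<odot>\<^bsub>M\<^esub> v) ` (\<mm> +>\<^bsub>R\<^esub> r)"
    by (rule image_cong[OF refl])
  also have "\<dots> = {r \<odot>\<^bsub>M\<^esub> v}"
    by (rule image_constant) (rule a_rcos_self[OF assms(3)])
  finally have "(\<lambda>s. s \<odot>\<^bsub>M\<^esub> v) ` (\<mm> +>\<^bsub>R\<^esub> r) = {r \<odot>\<^bsub>M\<^esub> v}" .
  then show ?thesis
    by (simp add: socle_space_def)
qed

lemma (in module) vectorspace_socle_space:
  assumes "maximalideal \<mm> R"
  shows "vectorspace (R Quot \<mm>) (socle_space \<mm> M)"
proof -
  interpret maximalideal \<mm> R by fact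
  interpret K: field "R Quot \<mm>"
    by (rule quotient_is_field) (rule is_cring)
  interpret S: submodule R "socle \<mm> M" M
    by (rule submodule_socle) (rule ideal_axioms)
  interpret SM: module R "M\<lparr>carrier := socle \<mm> M\<rparr>"
    by (rule submodule_is_module) (rule S.submodule_axioms)
  note smult = socle_space_smult[OF ideal_axioms]
  have coset: "\<exists>r\<in>carrier R. X = \<mm> +>\<^bsub>R\<^esub> r" if "X \<in> carrier (R Quot \<mm>)" for X
    using that by (auto simp: FactRing_def A_RCOSETS_def')
  have plus: "(\<mm> +>\<^bsub>R\<^esub> r) \<oplus>\<^bsub>R Quot \<mm>\<^esub> (\<mm> +>\<^bsub>R\<^esub> s) = \<mm> +>\<^bsub>R\<^esub> (r \<oplus>\<^bsub>R\<^esub> s)"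
    if "r \<in> carrier R" "s \<in> carrier R" for r s
    using that by (simp add: FactRing_def a_rcos_sum)
  have times: "(\<mm> +>\<^bsub>R\<^esub> r) \<otimes>\<^bsub>R Quot \<mm>\<^esub> (\<mm> +>\<^bsub>R\<^esub> s) = \<mm> +>\<^bsub>R\<^esub> (r \<otimes>\<^bsub>R\<^esub> s)"
    if "r \<in> carrier R" "s \<in> carrier R" for r s
    using that by (simp add: FactRing_def rcoset_mult_add)
  have carr: "v \<in> carrier M" if "v \<in> socle \<mm> M" for v
    using that by (simp add: socle_def)
  have sc: "carrier (socle_space \<mm> M) = socle \<mm> M"
    "add (socle_space \<mm> M) = add M"
    by (simp_all add: socle_space_def)
  have "module (R Quot \<mm>) (socle_space \<mm> M)"
  proof (rule moduleI)
    show "cring (R Quot \<mm>)" by (rule K.is_cring)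
    show "abelian_group (socle_space \<mm> M)"
    proof (rule abelian_groupI)
      show "\<exists>w\<in>carrier (socle_space \<mm> M). w \<oplus>\<^bsub>socle_space \<mm> M\<^esub> v = \<zero>\<^bsub>socle_space \<mm> M\<^esub>"
        if "v \<in> carrier (socle_space \<mm> M)" for v
        using SM.add.l_inv_ex[of v] that by (simp add: socle_space_def)
      show "v \<oplus>\<^bsub>socle_space \<mm> M\<^esub> w = w \<oplus>\<^bsub>socle_space \<mm> M\<^esub> v"
        if "v \<in> carrier (socle_space \<mm> M)" "w \<in> carrier (socle_space \<mm> M)" for v w
        using that M.a_comm[of v w] by (simp add: socle_space_def carr)
    qed (simp_all add: socle_space_def carr M.a_assoc)
  next
    fix X v
    assume "X \<in> carrier (R Quot \<mm>)" and v: "v \<in> carrier (socle_space \<mm> M)"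
    then obtain r where r: "r \<in> carrier R" "X = \<mm> +>\<^bsub>R\<^esub> r"
      using coset by blast
    show "X \<odot>\<^bsub>socle_space \<mm> M\<^esub> v \<in> carrier (socle_space \<mm> M)"
      using r v by (simp only: sc smult S.smult_closed)
    fix w
    assume w: "w \<in> carrier (socle_space \<mm> M)"
    show "X \<odot>\<^bsub>socle_space \<mm> M\<^esub> (v \<oplus>\<^bsub>socle_space \<mm> M\<^esub> w) =
      X \<odot>\<^bsub>socle_space \<mm> M\<^esub> v \<oplus>\<^bsub>socle_space \<mm> M\<^esub> X \<odot>\<^bsub>socle_space \<mm> M\<^esub> w"
      using r v w by (simp only: sc smult S.m_closed smult_r_distr carr)
  next
    fix X Y v
    assume "X \<in> carrier (R Quot \<mm>)" "Y \<in> carrier (R Quot \<mm>)"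
      and v: "v \<in> carrier (socle_space \<mm> M)"
    then obtain r s where rs: "r \<in> carrier R" "X = \<mm> +>\<^bsub>R\<^esub> r" "s \<in> carrier R" "Y = \<mm> +>\<^bsub>R\<^esub> s"
      using coset by blast
    show "(X \<oplus>\<^bsub>R Quot \<mm>\<^esub> Y) \<odot>\<^bsub>socle_space \<mm> M\<^esub> v =
      X \<odot>\<^bsub>socle_space \<mm> M\<^esub> v \<oplus>\<^bsub>socle_space \<mm> M\<^esub> Y \<odot>\<^bsub>socle_space \<mm> M\<^esub> v"
      using rs v by (simp only: sc smult plus smult_l_distr carr R.add.m_closed)
    show "(X \<otimes>\<^bsub>R Quot \<mm>\<^esub> Y) \<odot>\<^bsub>socle_space \<mm> M\<^esub> v =
      X \<odot>\<^bsub>socle_space \<mm> M\<^esub> (Y \<odot>\<^bsub>socle_space \<mm> M\<^esub> v)"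
      using rs v by (simp only: sc smult times smult_assoc1 carr R.m_closed S.smult_closed)
  next
    fix v
    assume v: "v \<in> carrier (socle_space \<mm> M)"
    have "\<one>\<^bsub>R Quot \<mm>\<^esub> = \<mm> +>\<^bsub>R\<^esub> \<one>\<^bsub>R\<^esub>"
      by (simp add: FactRing_def)
    then show "\<one>\<^bsub>R Quot \<mm>\<^esub> \<odot>\<^bsub>socle_space \<mm> M\<^esub> v = v"
      using v by (simp only: sc smult R.one_closed smult_one carr)
  qed
  then show ?thesis
    by (intro vectorspace.intro K.field_axioms)
qed

end

theory Submission
  imports Defs
begin

text \<open>Let \<open>d\<close> be the minimum distance of \<open>C\<close> and \<open>k = n + 1 - d\<close>. A codeword that vanishes on the first \<open>k\<close>
  coordinates has weight at most \<open>d - 1\<close>, so it is zero; hence \<open>C\<close> embeds into \<open>R\<^sup>k\<close> and its socle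
  embeds into the \<open>k\<close>-th power of the socle of \<open>R\<close>. Length and socle dimension are additive, so
  \<open>\<lambda>(C) \<le> k * \<lambda>(R)\<close> and \<open>type(C) \<le> k * type(R)\<close>, which are the two bounds multiplied out.

  Both inequalities become instances of one statement, \<open>length_at_most_of_information_set\<close>, because
  both invariants are measured by the same device: a strictly monotone function from the submodules
  to the natural numbers (\<open>length_at_most\<close>). Its least possible upper bound on the submodules of \<open>A\<close> is
  the length of \<open>A\<close>, and for a socle it is the dimension over the residue field. In place of an
  isomorphism with a power module, coordinates are peeled off one at a time with the kernel-image
  estimate \<open>length_at_most_kernel_image\<close>.

  The argument needs \<open>R\<close> to have finite length, since \<open>the_enat\<close> and \<open>vectorspace.dim\<close> say
  nothing in the infinite case. This is \<open>finite_length\<close>, a part of the Hopkins-Levitzki theorem. Instead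
  of showing that the radical is nilpotent, its proof looks at a minimal ideal \<open>I\<close> of infinite length:
  each ring element acts on \<open>I\<close> as zero or surjectively, which makes the annihilator of \<open>I\<close> a maximal
  ideal, so \<open>I\<close> is a vector space; it then has a hyperplane, of finite length by minimality, and
  so it has finite length itself.\<close>

section \<open>Rank functions on submodules\<close>

text \<open>A strictly monotone rank function on the submodules of \<open>A\<close> with values up to \<open>L\<close> is equivalent to a
  bound \<open>L\<close> on the length of chains, but rank functions can be added and pulled back
  along maps of submodules, where chains would have to be refined. All submodules are taken in the fixed
  ambient module \<open>M\<close>, and \<open>A\<close> may be any set, so that no change of carrier is needed.\<close>

definition length_at_most ::
    "('a, 'b) ring_scheme \<Rightarrow> ('a, 'c, 'd) module_scheme \<Rightarrow> 'c set \<Rightarrow> nat \<Rightarrow> bool"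
  where "length_at_most R M A L \<longleftrightarrow> (\<exists>\<rho> :: 'c set \<Rightarrow> nat.
    (\<forall>N. submodule R N M \<and> N \<subseteq> A \<longrightarrow> \<rho> N \<le> L) \<and>
    (\<forall>N N'. submodule R N M \<and> submodule R N' M \<and> N \<subset> N' \<and> N' \<subseteq> A \<longrightarrow> \<rho> N < \<rho> N'))"

lemma length_at_mostE:
  assumes "length_at_most R M A L"
  obtains \<rho> :: "'c set \<Rightarrow> nat" where
    "\<And>N. submodule R N M \<Longrightarrow> N \<subseteq> A \<Longrightarrow> \<rho> N \<le> L"
    "\<And>N N'. submodule R N M \<Longrightarrow> submodule R N' M \<Longrightarrow> N \<subset> N' \<Longrightarrow> N' \<subseteq> A \<Longrightarrow> \<rho> N < \<rho> N'"
    "\<And>N N'. submodule R N M \<Longrightarrow> submodule R N' M \<Longrightarrow> N \<subseteq> N' \<Longrightarrow> N' \<subseteq> A \<Longrightarrow> \<rho> N \<le> \<rho> N'"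
proof -
  from assms obtain \<rho> :: "'c set \<Rightarrow> nat" where \<rho>:
    "\<forall>N. submodule R N M \<and> N \<subseteq> A \<longrightarrow> \<rho> N \<le> L"
    "\<forall>N N'. submodule R N M \<and> submodule R N' M \<and> N \<subset> N' \<and> N' \<subseteq> A \<longrightarrow> \<rho> N < \<rho> N'"
    unfolding length_at_most_def by (elim exE conjE)
  have 1: "\<rho> N \<le> L" if "submodule R N M" "N \<subseteq> A" for N
    using \<rho>(1) that by simp
  have 2: "\<rho> N < \<rho> N'" if "submodule R N M" "submodule R N' M" "N \<subset> N'" "N' \<subseteq> A" for N N'
    using \<rho>(2) that by simp
  have 3: "\<rho> N \<le> \<rho> N'"
    if "submodule R N M" "submodule R N' M" "N \<subseteq> N'" "N' \<subseteq> A" for N N'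
    using 2[of N N'] that by (cases "N = N'") (auto simp: less_imp_le psubset_eq)
  from 1 2 3 show ?thesis by (rule that)
qed

lemma length_at_mostI:
  fixes \<rho> :: "'c set \<Rightarrow> nat"
  assumes "\<And>N. submodule R N M \<Longrightarrow> N \<subseteq> A \<Longrightarrow> \<rho> N \<le> L"
    and "\<And>N N'. submodule R N M \<Longrightarrow> submodule R N' M \<Longrightarrow> N \<subset> N' \<Longrightarrow> N' \<subseteq> A \<Longrightarrow> \<rho> N < \<rho> N'"
  shows "length_at_most R M A L"
  unfolding length_at_most_def using assms by (intro exI[of _ \<rho>]) blast

lemma length_at_most_mono:
  assumes "length_at_most R M B L" and "A \<subseteq> B" and "L \<le> L'"
  shows "length_at_most R M A L'"
proof -
  obtain \<rho> where
    1: "\<And>N. submodule R N M \<Longrightarrow> N \<subseteq> B \<Longrightarrow> \<rho> N \<le> L" and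
    2: "\<And>N N'. submodule R N M \<Longrightarrow> submodule R N' M \<Longrightarrow> N \<subset> N' \<Longrightarrow> N' \<subseteq> B \<Longrightarrow> \<rho> N < \<rho> N'"
    using assms(1) by (rule length_at_mostE) blast
  show ?thesis
  proof (rule length_at_mostI)
    show "\<rho> N \<le> L'" if "submodule R N M" "N \<subseteq> A" for N
      using 1[OF that(1)] that(2) assms(2,3) by force
    show "\<rho> N < \<rho> N'" if "submodule R N M" "submodule R N' M" "N \<subset> N'" "N' \<subseteq> A" for N N'
      using 2[OF that(1-3)] that(4) assms(2) by blast
  qed
qed

lemma (in module) submodule_zero: "submodule R {\<zero>\<^bsub>M\<^esub>} M"
  by (intro submodule.intro module_axioms) auto

lemma (in module) length_at_most_zero: "length_at_most R M {\<zero>\<^bsub>M\<^esub>} 0"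
proof (rule length_at_mostI)
  show "(\<lambda>_. 0) N < ((\<lambda>_. 0) N' :: nat)"
    if "submodule R N M" "submodule R N' M" "N \<subset> N'" "N' \<subseteq> {\<zero>\<^bsub>M\<^esub>}" for N N'
    using submodule.zero_closed[OF that(1)] that(3,4) by blast
qed simp

lemma (in module) submodule_Int:
  assumes "submodule R A M" and "submodule R B M"
  shows "submodule R (A \<inter> B) M"
  using assms by (auto simp: submodule_def)

lemma (in module) submodule_minus_closed:
  assumes "submodule R A M" and "v \<in> A" and "w \<in> A"
  shows "v \<ominus>\<^bsub>M\<^esub> w \<in> A"
proof -
  have "w \<in> carrier M"
    using assms submodule.subset by blast
  then have "\<ominus>\<^bsub>M\<^esub> w = (\<ominus> \<one>) \<odot>\<^bsub>M\<^esub> w"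
    by (simp add: smult_minus_1)
  then have "\<ominus>\<^bsub>M\<^esub> w \<in> A"
    using submodule.smult_closed[OF assms(1), of "\<ominus> \<one>" w] assms(3) by simp
  then show ?thesis
    using submodule.m_closed[OF assms(1,2)] by (simp add: a_minus_def)
qed

lemma (in module) submodule_add_right_cancel:
  assumes "submodule R A M" and "w \<in> A" and "v \<in> carrier M" and "v \<ominus>\<^bsub>M\<^esub> w \<in> A"
  shows "v \<in> A"
proof -
  have w: "w \<in> carrier M"
    using assms submodule.subset by blast
  have "v = (v \<ominus>\<^bsub>M\<^esub> w) \<oplus>\<^bsub>M\<^esub> w"
    using w assms(3) by (simp add: a_minus_def M.a_assoc M.l_neg)
  then show ?thesis
    using submodule.m_closed[OF assms(1,4,2)] by simp
qed

lemma (in mod_hom) submodule_image: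
  assumes "submodule R X M"
  shows "submodule R (f ` X) N"
proof (intro submodule.intro N.module_axioms)
  interpret X: submodule R X M by fact
  have c: "x \<in> carrier M" if "x \<in> X" for x
    using that X.subset by blast
  show "f ` X \<subseteq> carrier N"
    using c by blast
  show "\<zero>\<^bsub>N\<^esub> \<in> f ` X"
    using X.zero_closed f0_is_0 by (metis imageI)
  show "v \<oplus>\<^bsub>N\<^esub> w \<in> f ` X" if "v \<in> f ` X" "w \<in> f ` X" for v w
    using that c X.m_closed by (auto simp flip: f_add)
  show "r \<odot>\<^bsub>N\<^esub> v \<in> f ` X" if "r \<in> carrier R" "v \<in> f ` X" for r v
    using that c X.smult_closed by (auto simp flip: f_smult)
qed

text \<open>A submodule is determined among the submodules above it by its intersection with the kernel and
  its image, so the sum of a rank function of the kernel and one of the image is again strictly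
  monotone.\<close>

lemma (in mod_hom) length_at_most_kernel_image:
  assumes "length_at_most R M (A \<inter> ker) a" and "length_at_most R N (f ` A) b"
  shows "length_at_most R M A (a + b)"
proof -
  obtain \<rho>\<^sub>1 where
    k: "\<And>X. submodule R X M \<Longrightarrow> X \<subseteq> A \<inter> ker \<Longrightarrow> \<rho>\<^sub>1 X \<le> a"
      "\<And>X Y. submodule R X M \<Longrightarrow> submodule R Y M \<Longrightarrow> X \<subset> Y \<Longrightarrow> Y \<subseteq> A \<inter> ker \<Longrightarrow> \<rho>\<^sub>1 X < \<rho>\<^sub>1 Y"
      "\<And>X Y. submodule R X M \<Longrightarrow> submodule R Y M \<Longrightarrow> X \<subseteq> Y \<Longrightarrow> Y \<subseteq> A \<inter> ker \<Longrightarrow> \<rho>\<^sub>1 X \<le> \<rho>\<^sub>1 Y"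
    using assms(1) by (rule length_at_mostE) blast
  obtain \<rho>\<^sub>2 where
    i: "\<And>X. submodule R X N \<Longrightarrow> X \<subseteq> f ` A \<Longrightarrow> \<rho>\<^sub>2 X \<le> b"
      "\<And>X Y. submodule R X N \<Longrightarrow> submodule R Y N \<Longrightarrow> X \<subset> Y \<Longrightarrow> Y \<subseteq> f ` A \<Longrightarrow> \<rho>\<^sub>2 X < \<rho>\<^sub>2 Y"
      "\<And>X Y. submodule R X N \<Longrightarrow> submodule R Y N \<Longrightarrow> X \<subseteq> Y \<Longrightarrow> Y \<subseteq> f ` A \<Longrightarrow> \<rho>\<^sub>2 X \<le> \<rho>\<^sub>2 Y"
    using assms(2) by (rule length_at_mostE) blast
  have sub: "submodule R (X \<inter> ker) M" "submodule R (f ` X) N" if "submodule R X M" for X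
    using that ker_is_submodule M.submodule_Int submodule_image by blast+
  show ?thesis
  proof (rule length_at_mostI[where \<rho> = "\<lambda>X. \<rho>\<^sub>1 (X \<inter> ker) + \<rho>\<^sub>2 (f ` X)"])
    show "\<rho>\<^sub>1 (X \<inter> ker) + \<rho>\<^sub>2 (f ` X) \<le> a + b" if "submodule R X M" "X \<subseteq> A" for X
      using k(1)[OF sub(1)[OF that(1)]] i(1)[OF sub(2)[OF that(1)]] that(2)
      by (intro add_mono) blast+
    show "\<rho>\<^sub>1 (X \<inter> ker) + \<rho>\<^sub>2 (f ` X) < \<rho>\<^sub>1 (Y \<inter> ker) + \<rho>\<^sub>2 (f ` Y)"
      if X: "submodule R X M" and Y: "submodule R Y M" and "X \<subset> Y" "Y \<subseteq> A" for X Y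
    proof -
      have le: "\<rho>\<^sub>1 (X \<inter> ker) \<le> \<rho>\<^sub>1 (Y \<inter> ker)" "\<rho>\<^sub>2 (f ` X) \<le> \<rho>\<^sub>2 (f ` Y)"
        using that by (auto intro!: k(3) i(3) sub)
      have "X \<inter> ker \<subset> Y \<inter> ker \<or> f ` X \<subset> f ` Y"
      proof (rule ccontr)
        assume "\<not> ?thesis"
        then have eq: "X \<inter> ker = Y \<inter> ker" "f ` X = f ` Y"
          using \<open>X \<subset> Y\<close> by blast+
        have "Y \<subseteq> X"
        proof
          fix y assume y: "y \<in> Y"
          then obtain x where x: "x \<in> X" "f y = f x"
            using eq(2) by blast
          have c: "x \<in> carrier M" "y \<in> carrier M"
            using x y X Y submodule.subset by blast+
          have "y \<ominus>\<^bsub>M\<^esub> x \<in> Y"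
            using M.submodule_minus_closed[OF Y y] x \<open>X \<subset> Y\<close> by blast
          moreover have "y \<ominus>\<^bsub>M\<^esub> x \<in> ker"
            using c x by (simp add: ker_def)
          ultimately have "y \<ominus>\<^bsub>M\<^esub> x \<in> X"
            using eq(1) by blast
          then show "y \<in> X"
            using M.submodule_add_right_cancel[OF X x(1) c(2)] by blast
        qed
        then show False
          using \<open>X \<subset> Y\<close> by blast
      qed
      then show ?thesis
      proof
        assume "X \<inter> ker \<subset> Y \<inter> ker"
        then have "\<rho>\<^sub>1 (X \<inter> ker) < \<rho>\<^sub>1 (Y \<inter> ker)"
          using that by (intro k(2) sub) auto
        then show ?thesis using le by linarith
      next
        assume "f ` X \<subset> f ` Y"
        then have "\<rho>\<^sub>2 (f ` X) < \<rho>\<^sub>2 (f ` Y)"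
          using that by (intro i(2) sub) auto
        then show ?thesis using le by linarith
      qed
    qed
  qed
qed

text \<open>This is the inverse of a nonzero element of the residue field, written without cosets.\<close>

lemma (in maximalideal) inverse_modulo:
  assumes "cring R" and "r \<in> carrier R" and "r \<notin> I"
  shows "\<exists>s\<in>carrier R. \<one> \<ominus> s \<otimes> r \<in> I"
proof -
  interpret cring R by fact
  have J: "ideal (I <+>\<^bsub>R\<^esub> PIdl r) R"
    using add_ideals[OF is_ideal cgenideal_ideal[OF assms(2)]] .
  have mem: "h \<oplus> s \<otimes> r \<in> I <+>\<^bsub>R\<^esub> PIdl r" if "h \<in> I" "s \<in> carrier R" for h s
    using that by (auto simp: set_add_def' cgenideal_def)
  have "I \<subseteq> I <+>\<^bsub>R\<^esub> PIdl r"
    using mem[of _ \<zero>] assms(2) a_Hcarr by auto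
  moreover have "r \<in> I <+>\<^bsub>R\<^esub> PIdl r"
    using mem[of \<zero> \<one>] assms(2) by simp
  ultimately have "I <+>\<^bsub>R\<^esub> PIdl r = carrier R"
    using I_maximal[OF J] assms(3) ideal.Icarr[OF J] by blast
  then have "\<one> \<in> I <+>\<^bsub>R\<^esub> PIdl r"
    by simp
  then obtain h s where hs: "h \<in> I" "s \<in> carrier R" "\<one> = h \<oplus> s \<otimes> r"
    by (auto simp: set_add_def' cgenideal_def)
  have "\<one> \<ominus> s \<otimes> r = h"
    using hs assms(2) a_Hcarr[OF hs(1)] by (simp add: a_minus_def a_assoc r_neg)
  then show ?thesis
    using hs by blast
qed

text \<open>The quotient of \<open>A + R v\<close> by \<open>A\<close> is killed by \<open>\<mm>\<close> and cyclic, so it is simple or zero, and a rank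
  function of \<open>A\<close> extends by adding one to every submodule that sticks out of \<open>A\<close>.\<close>

lemma (in module) length_at_most_simple_extension:
  assumes "maximalideal \<mm> R" and "submodule R A M" and v: "v \<in> carrier M"
    and ann: "\<And>r. r \<in> \<mm> \<Longrightarrow> r \<odot>\<^bsub>M\<^esub> v \<in> A"
    and gen: "\<And>x. x \<in> B \<Longrightarrow> \<exists>a\<in>A. \<exists>r\<in>carrier R. x = a \<oplus>\<^bsub>M\<^esub> r \<odot>\<^bsub>M\<^esub> v"
    and len: "length_at_most R M A L"
  shows "length_at_most R M B (Suc L)"
proof -
  interpret maximalideal \<mm> R by fact
  interpret A: submodule R A M by fact
  have Ac: "a \<in> carrier M" if "a \<in> A" for a
    using that A.subset by blast
  obtain \<rho> where
    k: "\<And>X. submodule R X M \<Longrightarrow> X \<subseteq> A \<Longrightarrow> \<rho> X \<le> L"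
      "\<And>X Y. submodule R X M \<Longrightarrow> submodule R Y M \<Longrightarrow> X \<subset> Y \<Longrightarrow> Y \<subseteq> A \<Longrightarrow> \<rho> X < \<rho> Y"
      "\<And>X Y. submodule R X M \<Longrightarrow> submodule R Y M \<Longrightarrow> X \<subseteq> Y \<Longrightarrow> Y \<subseteq> A \<Longrightarrow> \<rho> X \<le> \<rho> Y"
    using len by (rule length_at_mostE) blast
  have sub: "submodule R (X \<inter> A) M" if "submodule R X M" for X
    using that A.submodule_axioms submodule_Int by blast
  \<comment> \<open>A submodule \<open>X\<close> that sticks out of \<open>A\<close> contains \<open>v\<close> modulo \<open>A\<close>; above it, only the part
    inside \<open>A\<close> can grow.\<close>
  have full: "Y \<inter> A \<noteq> X \<inter> A"
    if X: "submodule R X M" and Y: "submodule R Y M" and "X \<subset> Y" "Y \<subseteq> B" and nA: "\<not> X \<subseteq> A"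
    for X Y
  proof
    assume eq: "Y \<inter> A = X \<inter> A"
    interpret X: submodule R X M by fact
    obtain u where u: "u \<in> X" "u \<notin> A" using nA by blast
    then have "u \<in> B"
      using \<open>X \<subset> Y\<close> \<open>Y \<subseteq> B\<close> by blast
    then obtain a r where ar: "a \<in> A" "r \<in> carrier R" "u = a \<oplus>\<^bsub>M\<^esub> r \<odot>\<^bsub>M\<^esub> v"
      using gen by blast
    have "r \<notin> \<mm>"
      using ar u ann A.m_closed by blast
    then obtain s where s: "s \<in> carrier R" "\<one> \<ominus> s \<otimes> r \<in> \<mm>"
      using inverse_modulo[OF R.is_cring ar(2)] by blast
    \<comment> \<open>Dividing \<open>u = a + r v\<close> by \<open>r\<close> modulo \<open>\<mm>\<close> expresses \<open>v\<close> by \<open>u\<close>, up to this error term in \<open>A\<close>.\<close>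
    define c where "c = (\<one> \<ominus> s \<otimes> r) \<odot>\<^bsub>M\<^esub> v \<ominus>\<^bsub>M\<^esub> s \<odot>\<^bsub>M\<^esub> a"
    have c: "c \<in> A"
      unfolding c_def using ann s ar(1) by (intro submodule_minus_closed[OF assms(2)]) auto
    have uc: "u \<in> carrier M"
      using u X.subset by blast
    have v_eq: "v = c \<oplus>\<^bsub>M\<^esub> s \<odot>\<^bsub>M\<^esub> u"
    proof -
      have p: "s \<odot>\<^bsub>M\<^esub> a \<in> carrier M" "(s \<otimes> r) \<odot>\<^bsub>M\<^esub> v \<in> carrier M"
        "(\<one> \<ominus> s \<otimes> r) \<odot>\<^bsub>M\<^esub> v \<in> carrier M"
        using s ar Ac v by auto
      have "c \<oplus>\<^bsub>M\<^esub> s \<odot>\<^bsub>M\<^esub> u =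
        ((\<one> \<ominus> s \<otimes> r) \<odot>\<^bsub>M\<^esub> v \<ominus>\<^bsub>M\<^esub> s \<odot>\<^bsub>M\<^esub> a) \<oplus>\<^bsub>M\<^esub> (s \<odot>\<^bsub>M\<^esub> a \<oplus>\<^bsub>M\<^esub> (s \<otimes> r) \<odot>\<^bsub>M\<^esub> v)"
        using s ar Ac v by (simp add: c_def smult_r_distr smult_assoc1)
      also have "\<dots> = (\<one> \<ominus> s \<otimes> r) \<odot>\<^bsub>M\<^esub> v \<oplus>\<^bsub>M\<^esub> (s \<otimes> r) \<odot>\<^bsub>M\<^esub> v"
        using p by (simp add: a_minus_def M.a_assoc M.r_neg1)
      also have "\<dots> = ((\<one> \<ominus> s \<otimes> r) \<oplus> s \<otimes> r) \<odot>\<^bsub>M\<^esub> v"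
        using s ar v by (simp add: smult_l_distr)
      also have "(\<one> \<ominus> s \<otimes> r) \<oplus> s \<otimes> r = \<one>"
        using s ar by (simp add: a_minus_def R.a_assoc R.l_neg)
      finally show ?thesis using v by simp
    qed
    have "Y \<subseteq> X"
    proof
      fix w assume w: "w \<in> Y"
      then have wc: "w \<in> carrier M"
        using Y submodule.subset by blast
      obtain b t where bt: "b \<in> A" "t \<in> carrier R" "w = b \<oplus>\<^bsub>M\<^esub> t \<odot>\<^bsub>M\<^esub> v"
        using gen w \<open>Y \<subseteq> B\<close> by blast
      have tsu: "t \<odot>\<^bsub>M\<^esub> (s \<odot>\<^bsub>M\<^esub> u) \<in> X"
        using bt s u by auto
      have "w = (b \<oplus>\<^bsub>M\<^esub> t \<odot>\<^bsub>M\<^esub> c) \<oplus>\<^bsub>M\<^esub> t \<odot>\<^bsub>M\<^esub> (s \<odot>\<^bsub>M\<^esub> u)"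
        using bt(1,2) s uc Ac c by (subst bt(3), subst v_eq) (simp add: smult_r_distr M.a_assoc)
      then have "w \<ominus>\<^bsub>M\<^esub> t \<odot>\<^bsub>M\<^esub> (s \<odot>\<^bsub>M\<^esub> u) = b \<oplus>\<^bsub>M\<^esub> t \<odot>\<^bsub>M\<^esub> c"
        using bt(1,2) s uc Ac c by (simp add: a_minus_def M.a_assoc M.r_neg)
      then have "w \<ominus>\<^bsub>M\<^esub> t \<odot>\<^bsub>M\<^esub> (s \<odot>\<^bsub>M\<^esub> u) \<in> A"
        using bt c by auto
      moreover have "w \<ominus>\<^bsub>M\<^esub> t \<odot>\<^bsub>M\<^esub> (s \<odot>\<^bsub>M\<^esub> u) \<in> Y"
        using submodule_minus_closed[OF Y w] tsu \<open>X \<subset> Y\<close> by blast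
      ultimately have "w \<ominus>\<^bsub>M\<^esub> t \<odot>\<^bsub>M\<^esub> (s \<odot>\<^bsub>M\<^esub> u) \<in> X"
        using eq by blast
      then show "w \<in> X"
        using submodule_add_right_cancel[OF X tsu wc] by blast
    qed
    then show False
      using \<open>X \<subset> Y\<close> by blast
  qed
  show ?thesis
  proof (rule length_at_mostI[where \<rho> = "\<lambda>X. \<rho> (X \<inter> A) + (if X \<subseteq> A then 0 else 1)"])
    show "\<rho> (X \<inter> A) + (if X \<subseteq> A then 0 else 1) \<le> Suc L" if "submodule R X M" "X \<subseteq> B" for X
      using k(1)[OF sub[OF that(1)]] by simp
    show "\<rho> (X \<inter> A) + (if X \<subseteq> A then 0 else 1) < \<rho> (Y \<inter> A) + (if Y \<subseteq> A then 0 else 1)"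
      if XY: "submodule R X M" "submodule R Y M" "X \<subset> Y" "Y \<subseteq> B" for X Y
    proof -
      have le: "\<rho> (X \<inter> A) \<le> \<rho> (Y \<inter> A)"
        using XY by (intro k(3) sub) auto
      have less: "\<rho> (X \<inter> A) < \<rho> (Y \<inter> A)" if "X \<inter> A \<noteq> Y \<inter> A"
        using XY that by (intro k(2) sub) auto
      consider "Y \<subseteq> A" | "X \<subseteq> A" "\<not> Y \<subseteq> A" | "\<not> X \<subseteq> A" "\<not> Y \<subseteq> A"
        using XY by blast
      then show ?thesis
      proof cases
        case 1
        then have "X \<inter> A \<noteq> Y \<inter> A" using XY by blast
        with 1 XY less show ?thesis by auto
      next
        case 2
        with le show ?thesis by simp
      next
        case 3
        with full[OF XY] have "\<rho> (X \<inter> A) < \<rho> (Y \<inter> A)"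
          by (intro less) blast
        with 3 show ?thesis by simp
      qed
    qed
  qed
qed

section \<open>Length\<close>

lemma (in module) submodule_restrict_carrier:
  assumes "submodule R A M"
  shows "submodule R N (M\<lparr>carrier := A\<rparr>) \<longleftrightarrow> submodule R N M \<and> N \<subseteq> A"
  using submodule_is_module[OF assms] module_axioms submodule.subset[OF assms]
  by (auto simp: submodule_def)

lemma (in module) length_at_most_restrict_carrier:
  assumes "submodule R A M" and "length_at_most R M B L"
  shows "length_at_most R (M\<lparr>carrier := A\<rparr>) B L"
proof -
  obtain \<rho> where
    "\<And>N. submodule R N M \<Longrightarrow> N \<subseteq> B \<Longrightarrow> \<rho> N \<le> L" and
    "\<And>N N'. submodule R N M \<Longrightarrow> submodule R N' M \<Longrightarrow> N \<subset> N' \<Longrightarrow> N' \<subseteq> B \<Longrightarrow> \<rho> N < \<rho> N'"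
    using assms(2) by (rule length_at_mostE) blast
  then show ?thesis
    by (intro length_at_mostI[where \<rho> = \<rho>]) (simp_all add: submodule_restrict_carrier[OF assms(1)])
qed

lemma module_length_le_if_length_at_most:
  assumes "length_at_most R M (carrier M) L"
  shows "module_length R M \<le> enat L"
proof -
  obtain \<rho> where
    bound: "\<And>N. submodule R N M \<Longrightarrow> N \<subseteq> carrier M \<Longrightarrow> \<rho> N \<le> L" and
    strict: "\<And>N N'. submodule R N M \<Longrightarrow> submodule R N' M \<Longrightarrow> N \<subset> N' \<Longrightarrow> N' \<subseteq> carrier M \<Longrightarrow>
      \<rho> N < \<rho> N'"
    using assms by (rule length_at_mostE) blast
  have "l \<le> L" if sub: "\<And>i. i \<le> l \<Longrightarrow> submodule R (N i) M" and up: "\<And>i. i < l \<Longrightarrow> N i \<subset> N (Suc i)"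
    for l N
  proof -
    have "i \<le> \<rho> (N i)" if "i \<le> l" for i
      using that
    proof (induction i)
      case (Suc i)
      have "\<rho> (N i) < \<rho> (N (Suc i))"
        using Suc.prems by (intro strict sub up submodule.subset[OF sub]) auto
      with Suc show ?case by auto
    qed simp
    also have "\<rho> (N l) \<le> L"
      by (intro bound sub submodule.subset[OF sub]) simp_all
    finally show ?thesis by simp
  qed
  then show ?thesis
    unfolding module_length_def by (intro Sup_least) (clarsimp, blast)
qed

text \<open>The rank of a submodule is the length of the longest chain below it; extending such a chain by a
  strictly larger submodule shows strict monotonicity.\<close>

lemma (in module) length_at_most_if_module_length_le:
  assumes "module_length R M \<le> enat L"
  shows "length_at_most R M (carrier M) L"
proof -
  define S :: "'c set \<Rightarrow> nat set" where "S X = {l. \<exists>N :: nat \<Rightarrow> 'c set.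
    (\<forall>i\<le>l. submodule R (N i) M) \<and> (\<forall>i<l. N i \<subset> N (Suc i)) \<and> N l \<subseteq> X}" for X
  have le: "l \<le> L" if "l \<in> S X" for l X
  proof -
    have "enat l \<le> module_length R M"
      unfolding module_length_def using that by (intro Sup_upper) (auto simp: S_def)
    then show ?thesis
      using assms by (metis enat_ord_simps(1) order_trans)
  qed
  have fin: "finite (S X)" for X
    using le by (meson finite_nat_set_iff_bounded_le)
  have ne: "S X \<noteq> {}" if "submodule R X M" for X
  proof -
    have "0 \<in> S X"
      unfolding S_def using that by (auto intro!: exI[of _ "\<lambda>_. X"])
    then show ?thesis by blast
  qed
  show ?thesis
  proof (rule length_at_mostI[where \<rho> = "\<lambda>X. Max (S X)"])
    show "Max (S X) \<le> L" if "submodule R X M" for X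
      using le Max_in[OF fin ne[OF that]] by blast
    show "Max (S X) < Max (S Y)" if X: "submodule R X M" and Y: "submodule R Y M" and "X \<subset> Y" for X Y
    proof -
      define m where "m = Max (S X)"
      have m_mem: "m \<in> S X"
        unfolding m_def by (rule Max_in[OF fin ne[OF X]])
      obtain N where N: "\<And>i. i \<le> m \<Longrightarrow> submodule R (N i) M"
        "\<And>i. i < m \<Longrightarrow> N i \<subset> N (Suc i)" "N (m) \<subseteq> X"
        using m_mem unfolding S_def by blast
      have "Suc (m) \<in> S Y"
        unfolding S_def mem_Collect_eq
      proof (intro exI[of _ "N(Suc (m) := Y)"] conjI allI impI)
        fix i
        show "submodule R ((N(Suc (m) := Y)) i) M" if "i \<le> Suc (m)"
          using N(1)[of i] Y that by (cases "i = Suc (m)") simp_all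
        show "(N(Suc (m) := Y)) i \<subset> (N(Suc (m) := Y)) (Suc i)"
          if "i < Suc (m)"
          using N(2)[of i] N(3) \<open>X \<subset> Y\<close> that by (cases "i = m") auto
      qed simp
      then show ?thesis
        using Max_ge[OF fin] Suc_le_eq unfolding m_def by blast
    qed
  qed
qed


section \<open>Artinian rings have finite length\<close>

lemma (in cring) submodule_self_module_iff:
  "submodule R I (self_module R) \<longleftrightarrow> ideal I R"
proof
  assume "submodule R I (self_module R)"
  then interpret I: submodule R I "self_module R" .
  interpret S: module R "self_module R" by (rule module_self_module)
  have sub: "I \<subseteq> carrier R"
    using I.subset by (simp add: self_module_def)
  have add: "a \<oplus> b \<in> I" if "a \<in> I" "b \<in> I" for a b
    using I.m_closed[OF that] by (simp add: self_module_def)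
  have mult: "x \<otimes> a \<in> I" if "a \<in> I" "x \<in> carrier R" for a x
    using I.smult_closed[OF that(2,1)] by (simp add: self_module_def)
  have neg: "\<ominus> a \<in> I" if "a \<in> I" for a
    using mult[OF that, of "\<ominus> \<one>"] that sub by (simp add: l_minus subset_iff)
  have zero: "\<zero> \<in> I"
    using I.zero_closed by (simp add: self_module_def)
  show "ideal I R"
  proof (rule idealI)
    show "subgroup I (add_monoid R)"
    proof (rule subgroup.intro)
      show "inv\<^bsub>add_monoid R\<^esub> a \<in> I" if "a \<in> I" for a
        using neg[OF that] unfolding a_inv_def .
    qed (simp_all add: sub add zero)
    show "a \<otimes> x \<in> I" if "a \<in> I" "x \<in> carrier R" for a x
      using mult[OF that] by (subst m_comm) (use that sub in blast)+
  qed (rule ring_axioms, rule mult)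
next
  assume "ideal I R"
  then interpret ideal I R .
  show "submodule R I (self_module R)"
    using a_Hcarr I_l_closed
    by (intro submodule.intro module_self_module) (auto simp: self_module_def)
qed

text \<open>In a vector space such a maximal \<open>J\<close> is a hyperplane, a complement of the line through \<open>v\<close>.\<close>

lemma (in module) exists_maximal_submodule_avoiding:
  assumes "v \<in> carrier M" and "v \<noteq> \<zero>\<^bsub>M\<^esub>"
  obtains J where "submodule R J M" and "v \<notin> J"
    and "\<And>N. submodule R N M \<Longrightarrow> J \<subset> N \<Longrightarrow> v \<in> N"
proof -
  define \<A> where "\<A> = {N. submodule R N M \<and> v \<notin> N}"
  have "\<exists>J\<in>\<A>. \<forall>N\<in>\<A>. J \<subseteq> N \<longrightarrow> N = J"
  proof (rule subset_Zorn_nonempty)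
    show "\<A> \<noteq> {}"
      using submodule_zero assms(2) by (auto simp: \<A>_def)
    fix \<C>
    assume ne: "\<C> \<noteq> {}" and ch: "subset.chain \<A> \<C>"
    have sub: "submodule R N M" "v \<notin> N" if "N \<in> \<C>" for N
      using ch that by (auto simp: \<A>_def subset_chain_def)
    have dir: "\<exists>N\<in>\<C>. a \<in> N \<and> b \<in> N" if "a \<in> \<Union>\<C>" "b \<in> \<Union>\<C>" for a b
    proof -
      obtain A B where AB: "A \<in> \<C>" "a \<in> A" "B \<in> \<C>" "b \<in> B"
        using \<open>a \<in> \<Union>\<C>\<close> \<open>b \<in> \<Union>\<C>\<close> by blast
      then have "A \<subseteq> B \<or> B \<subseteq> A"
        using ch by (simp add: subset_chain_def)
      then show ?thesis
        using AB by blast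
    qed
    have "submodule R (\<Union>\<C>) M"
    proof (intro submodule.intro module_axioms)
      show "\<Union>\<C> \<subseteq> carrier M"
        using submodule.subset[OF sub(1)] by blast
      show "\<zero>\<^bsub>M\<^esub> \<in> \<Union>\<C>"
        using ne submodule.zero_closed[OF sub(1)] by blast
      show "a \<oplus>\<^bsub>M\<^esub> b \<in> \<Union>\<C>" if "a \<in> \<Union>\<C>" "b \<in> \<Union>\<C>" for a b
        using dir[OF that] submodule.m_closed[OF sub(1)] by blast
      show "c \<odot>\<^bsub>M\<^esub> a \<in> \<Union>\<C>" if "c \<in> carrier R" "a \<in> \<Union>\<C>" for c a
        using that submodule.smult_closed[OF sub(1)] by blast
    qed
    then show "\<Union>\<C> \<in> \<A>"
      using sub by (auto simp: \<A>_def)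
  qed
  then show ?thesis
    using that unfolding \<A>_def by blast
qed

lemma (in module) submodule_plus_cyclic:
  assumes "submodule R A M" and "v \<in> carrier M"
  obtains B where "submodule R B M" and "A \<subseteq> B" and "v \<in> B"
    and "\<And>x. x \<in> B \<Longrightarrow> \<exists>a\<in>A. \<exists>r\<in>carrier R. x = a \<oplus>\<^bsub>M\<^esub> r \<odot>\<^bsub>M\<^esub> v"
proof -
  interpret A: submodule R A M by fact
  have Ac: "a \<in> carrier M" if "a \<in> A" for a
    using that A.subset by blast
  define B where "B = {a \<oplus>\<^bsub>M\<^esub> r \<odot>\<^bsub>M\<^esub> v | a r. a \<in> A \<and> r \<in> carrier R}"
  have mem: "a \<oplus>\<^bsub>M\<^esub> r \<odot>\<^bsub>M\<^esub> v \<in> B" if "a \<in> A" "r \<in> carrier R" for a r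
    using that by (auto simp: B_def)
  have gen: "\<exists>a\<in>A. \<exists>r\<in>carrier R. x = a \<oplus>\<^bsub>M\<^esub> r \<odot>\<^bsub>M\<^esub> v" if "x \<in> B" for x
    using that by (auto simp: B_def)
  have AB: "A \<subseteq> B"
    using mem[of _ \<zero>] Ac assms(2) by auto
  have vB: "v \<in> B"
    using mem[of "\<zero>\<^bsub>M\<^esub>" \<one>] assms(2) by simp
  have "submodule R B M"
  proof (intro submodule.intro module_axioms)
    show "B \<subseteq> carrier M"
      using Ac assms(2) by (auto simp: B_def)
    show "\<zero>\<^bsub>M\<^esub> \<in> B"
      using AB by auto
    show "x \<oplus>\<^bsub>M\<^esub> y \<in> B" if "x \<in> B" "y \<in> B" for x y
    proof -
      obtain a r b s where ab: "a \<in> A" "r \<in> carrier R" "x = a \<oplus>\<^bsub>M\<^esub> r \<odot>\<^bsub>M\<^esub> v"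
        "b \<in> A" "s \<in> carrier R" "y = b \<oplus>\<^bsub>M\<^esub> s \<odot>\<^bsub>M\<^esub> v"
        using gen \<open>x \<in> B\<close> \<open>y \<in> B\<close> by metis
      then have "x \<oplus>\<^bsub>M\<^esub> y = (a \<oplus>\<^bsub>M\<^esub> b) \<oplus>\<^bsub>M\<^esub> (r \<oplus> s) \<odot>\<^bsub>M\<^esub> v"
        using Ac assms(2) by (simp add: smult_l_distr M.a_ac)
      then show ?thesis
        using mem ab by auto
    qed
    show "c \<odot>\<^bsub>M\<^esub> x \<in> B" if "c \<in> carrier R" "x \<in> B" for c x
    proof -
      obtain a r where ar: "a \<in> A" "r \<in> carrier R" "x = a \<oplus>\<^bsub>M\<^esub> r \<odot>\<^bsub>M\<^esub> v"
        using gen \<open>x \<in> B\<close> by metis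
      then have "c \<odot>\<^bsub>M\<^esub> x = c \<odot>\<^bsub>M\<^esub> a \<oplus>\<^bsub>M\<^esub> (c \<otimes> r) \<odot>\<^bsub>M\<^esub> v"
        using Ac assms(2) that by (simp add: smult_r_distr smult_assoc1)
      then show ?thesis
        using mem ar that by auto
    qed
  qed
  then show ?thesis
    using that AB vB gen by blast
qed

lemma (in artinian_ring) exists_minimal_ideal:
  assumes "ideal J R" and "P J"
  obtains I where "ideal I R" and "P I" and "\<And>J. ideal J R \<Longrightarrow> J \<subset> I \<Longrightarrow> \<not> P J"
proof -
  define r where "r = {(J, I). ideal J R \<and> ideal I R \<and> J \<subset> I}"
  have "wf r"
    unfolding wf_iff_no_infinite_down_chain
  proof
    assume "\<exists>f. \<forall>i. (f (Suc i), f i) \<in> r"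
    then obtain f where f: "\<And>i. (f (Suc i), f i) \<in> r"
      by blast
    then have f: "ideal (f i) R" "f (Suc i) \<subset> f i" for i
      using f[of i] by (simp_all add: r_def)
    then obtain N where "\<forall>k\<ge>N. f k = f N"
      using descending_chain[of f] by blast
    then have "f (Suc N) = f N"
      using le_SucI by blast
    then show False
      using f(2)[of N] by simp
  qed
  then obtain I where "I \<in> {J. ideal J R \<and> P J}" "\<And>J. (J, I) \<in> r \<Longrightarrow> J \<notin> {J. ideal J R \<and> P J}"
    using assms wfE_min[of r J "{J. ideal J R \<and> P J}"] by blast
  then show ?thesis
    using that by (auto simp: r_def)
qed

lemma (in cring) mod_hom_multiplication:
  assumes "x \<in> carrier R"
  shows "mod_hom R (self_module R) (self_module R) (\<lambda>y. x \<otimes> y)"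
  using assms
  by (intro mod_hom.intro module_self_module mod_hom_axioms.intro)
    (auto simp: module_hom_def self_module_def r_distr m_lcomm)

text \<open>A proper subideal of the minimal \<open>I\<close> has finite length. So if multiplication by \<open>x\<close> neither kills nor maps \<open>I\<close>
  onto itself, then its kernel and image on \<open>I\<close> have finite length, and so does \<open>I\<close>. Let \<open>P\<close>
  be the annihilator of \<open>I\<close>. If \<open>y \<notin> P\<close>, then all powers of \<open>y\<close> map \<open>I\<close> onto itself, and
  \<open>y\<^sup>N = r y\<^sup>N\<^sup>+\<^sup>1\<close> for some \<open>N\<close>, by the descending chain condition. Hence \<open>1 - r y\<close> kills \<open>I\<close>,
  that is, \<open>y\<close> is invertible modulo \<open>P\<close>, so \<open>P\<close> is maximal. The hyperplane argument then bounds
  the length of \<open>I\<close>.\<close>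

lemma (in artinian_ring) finite_length:
  "\<exists>L. length_at_most R (self_module R) (carrier R) L"
proof (rule ccontr)
  interpret S: module R "self_module R" by (rule module_self_module)
  have S_simps: "carrier (self_module R) = carrier R" "zero (self_module R) = \<zero>"
    "add (self_module R) = add R" "smult (self_module R) = mult R"
    by (simp_all add: self_module_def)
  define infinite_length where
    "infinite_length I \<longleftrightarrow> (\<forall>L. \<not> length_at_most R (self_module R) I L)" for I
  assume "\<not> ?thesis"
  then have "infinite_length (carrier R)"
    by (simp add: infinite_length_def)
  then obtain I where I: "ideal I R" "infinite_length I"
    and minimal: "\<And>J. ideal J R \<Longrightarrow> J \<subset> I \<Longrightarrow> \<not> infinite_length J"
    using exists_minimal_ideal[OF oneideal, of infinite_length] by blast
  have minimal: "\<exists>L. length_at_most R (self_module R) J L" if "ideal J R" "J \<subset> I" for J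
    using minimal[OF that] by (simp add: infinite_length_def)
  interpret I: ideal I R by (rule I(1))
  have Ic: "y \<in> carrier R" if "y \<in> I" for y
    using that by (rule I.a_Hcarr)
  have "\<not> I \<subseteq> {\<zero>}"
    using I(2) length_at_most_mono[OF S.length_at_most_zero, of I 0]
    by (auto simp: infinite_length_def S_simps)
  then obtain v where v: "v \<in> I" "v \<noteq> \<zero>"
    by blast
  define P where "P = {x \<in> carrier R. \<forall>y\<in>I. x \<otimes> y = \<zero>}"
  have P_kill: "x \<otimes> y = \<zero>" if "x \<in> P" "y \<in> I" for x y
    using that by (simp add: P_def)
  have onto: "(\<lambda>y. x \<otimes> y) ` I = I" if x: "x \<in> carrier R" "x \<notin> P" for x
  proof (rule ccontr)
    assume ne: "(\<lambda>y. x \<otimes> y) ` I \<noteq> I"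
    interpret h: mod_hom R "self_module R" "self_module R" "\<lambda>y. x \<otimes> y"
      by (rule mod_hom_multiplication) fact
    have "(\<lambda>y. x \<otimes> y) ` I \<subset> I"
      using ne I.I_l_closed x by blast
    moreover have "ideal ((\<lambda>y. x \<otimes> y) ` I) R"
      using h.submodule_image I(1) by (simp add: submodule_self_module_iff)
    ultimately obtain b where b: "length_at_most R (self_module R) ((\<lambda>y. x \<otimes> y) ` I) b"
      using minimal by blast
    have "I \<inter> h.ker \<subset> I"
      using x by (auto simp: h.ker_def S_simps P_def Ic)
    moreover have "ideal (I \<inter> h.ker) R"
      using I.is_ideal h.ker_is_submodule i_intersect by (simp add: submodule_self_module_iff)
    ultimately obtain a where a: "length_at_most R (self_module R) (I \<inter> h.ker) a"
      using minimal by blast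
    show False
      using h.length_at_most_kernel_image[OF a b] I(2) by (simp add: infinite_length_def)
  qed
  have P_ideal: "ideal P R"
    unfolding submodule_self_module_iff[symmetric]
    by (intro submodule.intro S.module_axioms)
      (auto simp: S_simps P_def l_distr m_assoc Ic)
  interpret P: ideal P R by (rule P_ideal)
  have P_max: "maximalideal P R"
  proof (rule maximalidealI[OF P_ideal])
    have "\<one> \<notin> P"
      using v l_one[OF Ic[OF v(1)]] unfolding P_def by force
    then show "carrier R \<noteq> P"
      using one_closed by blast
    fix J
    assume J: "ideal J R" "P \<subseteq> J" "J \<subseteq> carrier R"
    interpret J: ideal J R by (rule J(1))
    have "J = carrier R" if "J \<noteq> P"
    proof -
      obtain y where y: "y \<in> J" "y \<notin> P"
        using \<open>J \<noteq> P\<close> J(2) by blast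
      have yc: "y \<in> carrier R"
        using y(1) J(3) by blast
      have pow: "(\<lambda>z. y [^] k \<otimes> z) ` I = I" for k :: nat
      proof (induction k)
        case 0
        then show ?case using Ic by auto
      next
        case (Suc k)
        have "(\<lambda>z. y [^] Suc k \<otimes> z) ` I = (\<lambda>z. y [^] k \<otimes> z) ` ((\<lambda>z. y \<otimes> z) ` I)"
          unfolding image_image using yc Ic by (intro image_cong) (auto simp: m_assoc)
        then show ?case
          using onto[OF yc y(2)] Suc by simp
      qed
      have "\<exists>N :: nat. \<forall>k\<ge>N. PIdl (y [^] k) = PIdl (y [^] N)"
      proof (rule descending_chain[where I = "\<lambda>k :: nat. PIdl (y [^] k)"])
        show "PIdl (y [^] Suc k) \<subseteq> PIdl (y [^] k)" for k :: nat
        proof -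
          have "y [^] Suc k = y \<otimes> y [^] k"
            using yc nat_pow_comm[of y 1 k] by (simp add: m_comm)
          then have "y [^] Suc k \<in> PIdl (y [^] k)"
            using yc by (auto simp: cgenideal_def)
          then show ?thesis
            using cgenideal_minimal cgenideal_ideal yc by blast
        qed
      qed (use yc cgenideal_ideal in auto)
      then obtain N where "PIdl (y [^] Suc N) = PIdl (y [^] N)"
        using le_SucI by blast
      then have "y [^] N \<in> PIdl (y [^] Suc N)"
        using cgenideal_self yc by auto
      then obtain r where r: "r \<in> carrier R" "y [^] N = r \<otimes> y [^] Suc N"
        by (auto simp: cgenideal_def)
      have kill: "(\<one> \<ominus> r \<otimes> y) \<otimes> y [^] N = \<zero>"
      proof -
        have "(\<one> \<ominus> r \<otimes> y) \<otimes> y [^] N = y [^] N \<ominus> (r \<otimes> y) \<otimes> y [^] N"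
          using r(1) yc by (simp add: a_minus_def l_distr l_minus)
        also have "(r \<otimes> y) \<otimes> y [^] N = r \<otimes> y [^] Suc N"
          using r(1) yc by (simp add: m_ac)
        also have "\<dots> = y [^] N"
          using r(2) by simp
        finally show ?thesis
          using yc by (simp add: a_minus_def r_neg)
      qed
      have "(\<one> \<ominus> r \<otimes> y) \<otimes> z = \<zero>" if "z \<in> I" for z
      proof -
        obtain w where "w \<in> I" "z = y [^] N \<otimes> w"
          using pow[of N] \<open>z \<in> I\<close> by blast
        then show ?thesis
          using kill r(1) yc Ic by (simp flip: m_assoc)
      qed
      moreover have "\<one> \<ominus> r \<otimes> y \<in> carrier R"
        using r(1) yc by simp
      ultimately have "\<one> \<ominus> r \<otimes> y \<in> P"
        unfolding P_def by simp
      then have "\<one> \<ominus> r \<otimes> y \<in> J"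
        using J(2) by blast
      moreover have "r \<otimes> y \<in> J"
        using J.I_l_closed[OF y(1) r(1)] .
      ultimately have "(\<one> \<ominus> r \<otimes> y) \<oplus> r \<otimes> y \<in> J"
        by (rule J.a_closed)
      moreover have "(\<one> \<ominus> r \<otimes> y) \<oplus> r \<otimes> y = \<one>"
        using r(1) yc by (simp add: a_minus_def a_assoc l_neg)
      ultimately show ?thesis
        using J.one_imp_carrier by simp
    qed
    then show "J = P \<or> J = carrier R"
      by blast
  qed
  obtain J where J: "submodule R J (self_module R)" "v \<notin> J"
    and J_max: "\<And>N. submodule R N (self_module R) \<Longrightarrow> J \<subset> N \<Longrightarrow> v \<in> N"
    using S.exists_maximal_submodule_avoiding[of v] v Ic by (auto simp: S_simps)
  interpret J: ideal J R
    using J(1) by (simp add: submodule_self_module_iff)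
  have "ideal (J \<inter> I) R" "J \<inter> I \<subset> I"
    using i_intersect J.is_ideal I.is_ideal v J(2) by auto
  then obtain L where L: "length_at_most R (self_module R) (J \<inter> I) L"
    using minimal by blast
  \<comment> \<open>By maximality of \<open>J\<close>, the vector \<open>v\<close> lies in \<open>J + R x\<close>, and the coefficient of \<open>x\<close> can be inverted.\<close>
  have gen: "\<exists>a\<in>J \<inter> I. \<exists>r\<in>carrier R. x = a \<oplus> r \<otimes> v" if x: "x \<in> I" for x
  proof (cases "x \<in> J")
    case True
    then show ?thesis
      using x v Ic by (intro bexI[of _ x] bexI[of _ \<zero>]) auto
  next
    case False
    obtain B where B: "submodule R B (self_module R)" "J \<subseteq> B" "x \<in> B"
      "\<And>u. u \<in> B \<Longrightarrow> \<exists>a\<in>J. \<exists>r\<in>carrier R. u = a \<oplus> r \<otimes> x"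
      using S.submodule_plus_cyclic[OF J(1), of x] x Ic by (auto simp: S_simps)
    have "v \<in> B"
      using J_max[OF B(1)] B(2,3) False by blast
    then obtain j t where jt: "j \<in> J" "t \<in> carrier R" "v = j \<oplus> t \<otimes> x"
      using B(4) by blast
    have jc: "j \<in> carrier R"
      by (rule J.a_Hcarr[OF jt(1)])
    have "t \<notin> P"
    proof
      assume "t \<in> P"
      then have "v = j"
        unfolding jt(3) using P_kill x jc by simp
      then show False
        using jt(1) J(2) by simp
    qed
    then obtain s where s: "s \<in> carrier R" "\<one> \<ominus> s \<otimes> t \<in> P"
      using maximalideal.inverse_modulo[OF P_max is_cring jt(2)] by blast
    have "(\<one> \<ominus> s \<otimes> t) \<otimes> x = \<zero>"
      using P_kill[OF s(2) x] .
    then have "x \<ominus> (s \<otimes> t) \<otimes> x = \<zero>"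
      using s(1) jt(2) x Ic by (simp add: a_minus_def l_distr l_minus)
    then have stx: "(s \<otimes> t) \<otimes> x = x"
      using s(1) jt(2) x Ic by simp
    have "s \<otimes> v = s \<otimes> j \<oplus> x"
      unfolding jt(3) using s(1) jt(2) jc x Ic stx by (simp add: r_distr flip: m_assoc)
    then have eq: "x = \<ominus> (s \<otimes> j) \<oplus> s \<otimes> v"
      using s(1) jc x Ic by (simp add: r_neg1)
    have "\<ominus> (s \<otimes> j) \<in> J"
      using J.I_l_closed[OF jt(1) s(1)] by simp
    moreover have "\<ominus> (s \<otimes> j) \<in> I"
    proof -
      have "\<ominus> (s \<otimes> j) = x \<ominus> s \<otimes> v"
        using s(1) jc v Ic by (subst eq) (simp add: a_minus_def a_assoc r_neg)
      also have "\<dots> \<in> I"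
        using x v(1) s(1) I.I_l_closed by (simp add: a_minus_def)
      finally show ?thesis .
    qed
    ultimately show ?thesis
      using s(1) by (intro bexI[of _ "\<ominus> (s \<otimes> j)"] bexI[of _ s] eq) auto
  qed
  have "length_at_most R (self_module R) I (Suc L)"
  proof (rule S.length_at_most_simple_extension[OF P_max _ _ _ _ L, where v = v])
    show "submodule R (J \<inter> I) (self_module R)"
      using \<open>ideal (J \<inter> I) R\<close> by (simp add: submodule_self_module_iff)
    show "r \<odot>\<^bsub>self_module R\<^esub> v \<in> J \<inter> I" if "r \<in> P" for r
      using P_kill[OF that v(1)] by (simp add: S_simps)
  qed (use v Ic gen in \<open>auto simp: S_simps\<close>)
  then show False
    using I(2) by (simp add: infinite_length_def)
qed


section \<open>Socle dimension\<close>

text \<open>On the socle, \<open>R\<close> acts through its residue field; this lets rank functions for \<open>R\<close> and for the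
  residue field be identified in the two comparisons of length and dimension.\<close>

lemma (in module) submodule_socle_space_iff:
  assumes "maximalideal \<mm> R"
  shows "submodule (R Quot \<mm>) N (socle_space \<mm> M) \<longleftrightarrow> submodule R N M \<and> N \<subseteq> socle \<mm> M"
proof -
  interpret maximalideal \<mm> R by fact
  have sc: "carrier (socle_space \<mm> M) = socle \<mm> M" "add (socle_space \<mm> M) = add M"
    "zero (socle_space \<mm> M) = zero M"
    by (simp_all add: socle_space_def)
  note smult = socle_space_smult[OF is_ideal]
  have K: "carrier (R Quot \<mm>) = (\<lambda>r. \<mm> +> r) ` carrier R"
    by (auto simp: FactRing_def A_RCOSETS_def')
  have "module (R Quot \<mm>) (socle_space \<mm> M)"
    using vectorspace_socle_space[OF assms] vectorspace.axioms(1) by blast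
  moreover have "socle \<mm> M \<subseteq> carrier M"
    by (auto simp: socle_def)
  ultimately show ?thesis
    using module_axioms by (auto simp: submodule_def sc K smult subset_iff)
qed

text \<open>Among the finite sets \<open>B\<close> of socle vectors with at most as many elements as the rank of their
  span, one whose span has the largest rank must generate: a vector outside the span could be
  added to \<open>B\<close>, and the rank would grow at least as much as the cardinality.\<close>

lemma (in module) dim_socle_space_le:
  assumes "maximalideal \<mm> R" and "length_at_most R M (socle \<mm> M) L"
  shows "vectorspace.fin_dim (R Quot \<mm>) (socle_space \<mm> M)"
    and "vectorspace.dim (R Quot \<mm>) (socle_space \<mm> M) \<le> L"
proof -
  interpret V: vectorspace "R Quot \<mm>" "socle_space \<mm> M"
    by (rule vectorspace_socle_space) fact
  have V_carrier: "carrier (socle_space \<mm> M) = socle \<mm> M"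
    by (simp add: socle_space_def)
  obtain \<rho> where
    bound: "\<And>N. submodule R N M \<Longrightarrow> N \<subseteq> socle \<mm> M \<Longrightarrow> \<rho> N \<le> L" and
    strict: "\<And>N N'. submodule R N M \<Longrightarrow> submodule R N' M \<Longrightarrow> N \<subset> N' \<Longrightarrow> N' \<subseteq> socle \<mm> M \<Longrightarrow>
      \<rho> N < \<rho> N'"
    using assms(2) by (rule length_at_mostE) blast
  have span: "submodule R (V.span B) M" "V.span B \<subseteq> socle \<mm> M" "B \<subseteq> V.span B"
    if "B \<subseteq> socle \<mm> M" for B
    using V.span_is_submodule[of B] V.in_own_span[of B] that
    by (simp_all add: V_carrier submodule_socle_space_iff[OF assms(1)])
  define good where "good B \<longleftrightarrow> finite B \<and> B \<subseteq> socle \<mm> M \<and> card B \<le> \<rho> (V.span B)" for B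
  have "\<exists>B. good B \<and> (\<forall>B'. good B' \<longrightarrow> \<rho> (V.span B') \<le> \<rho> (V.span B))"
  proof (rule ex_has_greatest_nat[where b = "Suc L"])
    show "good {}" by (simp add: good_def)
    show "\<forall>B. good B \<longrightarrow> \<rho> (V.span B) < Suc L"
      using bound span by (auto simp: good_def less_Suc_eq_le)
  qed
  then obtain B where B: "finite B" "B \<subseteq> socle \<mm> M" "card B \<le> \<rho> (V.span B)"
    and max: "\<And>B'. good B' \<Longrightarrow> \<rho> (V.span B') \<le> \<rho> (V.span B)"
    by (auto simp: good_def)
  have "V.span B = socle \<mm> M"
  proof (rule ccontr)
    assume "V.span B \<noteq> socle \<mm> M"
    then obtain v where v: "v \<in> socle \<mm> M" "v \<notin> V.span B"
      using span(2)[OF B(2)] by blast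
    have iB: "insert v B \<subseteq> socle \<mm> M"
      using v B by blast
    have "V.span B \<subset> V.span (insert v B)"
      using V.span_is_monotone[of B "insert v B"] span(3)[OF iB] v by blast
    then have "\<rho> (V.span B) < \<rho> (V.span (insert v B))"
      using span iB B(2) by (intro strict) auto
    moreover have "card (insert v B) \<le> Suc (card B)"
      using B(1) by (simp add: card_insert_if)
    ultimately have "good (insert v B)"
      using B iB by (auto simp: good_def)
    then show False
      using max \<open>\<rho> (V.span B) < \<rho> (V.span (insert v B))\<close> by fastforce
  qed
  then have gen: "V.span B = carrier (socle_space \<mm> M)"
    by (simp add: V_carrier)
  then show "V.fin_dim"
    using B by (auto simp: V.fin_dim_def V_carrier)
  have "V.dim \<le> card B"
    using B gen by (intro V.gen_ge_dim) (auto simp: V_carrier)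
  also have "\<dots> \<le> L"
    using B bound[OF span(1,2)] by (meson order_trans)
  finally show "V.dim \<le> L" .
qed

text \<open>A basis builds up the socle by simple extensions, one for each basis vector. Finite dimension has
  to be assumed, since the value of \<open>dim\<close> carries no information otherwise.\<close>

lemma (in module) length_at_most_dim_socle_space:
  assumes "maximalideal \<mm> R" and "vectorspace.fin_dim (R Quot \<mm>) (socle_space \<mm> M)"
  shows "length_at_most R M (socle \<mm> M) (vectorspace.dim (R Quot \<mm>) (socle_space \<mm> M))"
proof -
  interpret \<mm>: maximalideal \<mm> R by fact
  interpret V: vectorspace "R Quot \<mm>" "socle_space \<mm> M"
    by (rule vectorspace_socle_space) fact
  have V_carrier: "carrier (socle_space \<mm> M) = socle \<mm> M"
    by (simp add: socle_space_def)
  note soc = submodule_socle[OF \<mm>.is_ideal]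
  have ex: "\<exists>A. submodule R A M \<and> B \<subseteq> A \<and> A \<subseteq> socle \<mm> M \<and> length_at_most R M A (card B)"
    if "finite B" "B \<subseteq> socle \<mm> M" for B
    using that
  proof (induction rule: finite_induct)
    case empty
    have "{\<zero>\<^bsub>M\<^esub>} \<subseteq> socle \<mm> M"
      using submodule.zero_closed[OF soc] by blast
    then show ?case
      using submodule_zero length_at_most_zero by (intro exI[of _ "{\<zero>\<^bsub>M\<^esub>}"]) simp
  next
    case (insert v B)
    then obtain A where A: "submodule R A M" "B \<subseteq> A" "A \<subseteq> socle \<mm> M" "length_at_most R M A (card B)"
      by blast
    have v: "v \<in> socle \<mm> M" "v \<in> carrier M"
      using insert.prems by (auto simp: socle_def)
    obtain A' where A': "submodule R A' M" "A \<subseteq> A'" "v \<in> A'"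
      "\<And>x. x \<in> A' \<Longrightarrow> \<exists>a\<in>A. \<exists>r\<in>carrier R. x = a \<oplus>\<^bsub>M\<^esub> r \<odot>\<^bsub>M\<^esub> v"
      using submodule_plus_cyclic[OF A(1) v(2)] by blast
    have "r \<odot>\<^bsub>M\<^esub> v \<in> A" if "r \<in> \<mm>" for r
      using v(1) that submodule.zero_closed[OF A(1)] by (simp add: socle_def)
    then have "length_at_most R M A' (Suc (card B))"
      using length_at_most_simple_extension[OF assms(1) A(1) v(2) _ A'(4) A(4)] by blast
    moreover have "A' \<subseteq> socle \<mm> M"
      using A'(4) A(3) v(1) submodule.m_closed[OF soc] submodule.smult_closed[OF soc] by blast
    ultimately show ?case
      using A A' insert.hyps by (intro exI[of _ A']) auto
  qed
  obtain B where B: "finite B" "V.basis B"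
    using V.finite_basis_exists assms(2) by blast
  then have B': "V.dim = card B" "B \<subseteq> socle \<mm> M" "V.span B = socle \<mm> M"
    using V.dim_basis by (auto simp: V.basis_def V_carrier)
  obtain A where A: "submodule R A M" "B \<subseteq> A" "A \<subseteq> socle \<mm> M" "length_at_most R M A (card B)"
    using ex[OF B(1) B'(2)] by blast
  have "socle \<mm> M \<subseteq> A"
    using V.span_is_subset[OF A(2)] A(1,3) B'(3) submodule_socle_space_iff[OF assms(1)] by blast
  then show ?thesis
    using A(4) B'(1) length_at_most_mono by (metis order_refl)
qed

section \<open>Codes\<close>

lemma (in cring) mod_hom_coordinate:
  assumes "i \<in> S"
  shows "mod_hom R (func_space S) (self_module R) (\<lambda>v. v i)"
  using assms
  by (intro mod_hom.intro module_self_module func_space_is_module mod_hom_axioms.intro)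
    (auto simp: module_hom_def self_module_def func_space_def)

text \<open>The first \<open>k\<close> coordinates determine the codewords. The subcodes of words that vanish on the first
  \<open>j\<close> coordinates decrease from \<open>C\<close> to zero as \<open>j\<close> runs from \<open>0\<close> to \<open>k\<close>, and each step is the kernel of
  a coordinate map with values in \<open>A\<close>, so it costs at most \<open>L\<close>. The set \<open>A\<close> will be \<open>R\<close> for the length and the
  socle of \<open>R\<close> for the type.\<close>

lemma (in cring) length_at_most_of_information_set:
  fixes n k :: nat
  assumes C: "submodule R C (power_module R n)" and "k \<le> n"
    and inj: "\<And>v. v \<in> C \<Longrightarrow> (\<And>i. i < k \<Longrightarrow> v i = \<zero>) \<Longrightarrow> v = \<zero>\<^bsub>power_module R n\<^esub>"
    and coord: "\<And>v i. v \<in> C \<Longrightarrow> i < k \<Longrightarrow> v i \<in> A"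
    and len: "length_at_most R (self_module R) A L"
  shows "length_at_most R (power_module R n) C (k * L)"
proof -
  interpret F: module R "power_module R n" by (rule func_space_is_module)
  define T where "T j = {v \<in> C. \<forall>i<j. v i = \<zero>}" for j
  have "length_at_most R (power_module R n) (T (k - j)) (j * L)" if "j \<le> k" for j
    using that
  proof (induction j)
    case 0
    have "T k \<subseteq> {\<zero>\<^bsub>power_module R n\<^esub>}"
      using inj by (auto simp: T_def)
    then show ?case
      using length_at_most_mono[OF F.length_at_most_zero] by simp
  next
    case (Suc j)
    define i where "i = k - Suc j"
    have i: "i < n" "i < k" "k - j = Suc i"
      using Suc.prems \<open>k \<le> n\<close> by (auto simp: i_def)
    interpret h: mod_hom R "power_module R n" "self_module R" "\<lambda>v. v i"
      using i(1) by (intro mod_hom_coordinate) simp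
    have "v i = \<zero>" if "v \<in> h.ker" for v
      using that unfolding h.ker_def by (simp add: self_module_def)
    then have "T i \<inter> h.ker \<subseteq> T (Suc i)"
      by (auto simp: T_def less_Suc_eq)
    then have "length_at_most R (power_module R n) (T i \<inter> h.ker) (j * L)"
    proof (rule length_at_most_mono[rotated])
      show "length_at_most R (power_module R n) (T (Suc i)) (j * L)"
        using Suc by (simp add: i(3))
    qed simp
    moreover have "(\<lambda>v. v i) ` T i \<subseteq> A"
      using coord i(2) by (auto simp: T_def)
    then have "length_at_most R (self_module R) ((\<lambda>v. v i) ` T i) L"
      using length_at_most_mono[OF len] by simp
    ultimately have "length_at_most R (power_module R n) (T i) (j * L + L)"
      by (rule h.length_at_most_kernel_image)
    then show ?case
      by (simp add: i_def add.commute)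
  qed
  from this[of k] show ?thesis
    by (simp add: T_def)
qed

lemma (in cring) hamming_weight_pos:
  assumes "v \<in> carrier (power_module R n)" and "v \<noteq> \<zero>\<^bsub>power_module R n\<^esub>"
  shows "0 < hamming_weight R n v"
proof -
  have "\<exists>i<n. v i \<noteq> \<zero>"
  proof (rule ccontr)
    assume "\<not> ?thesis"
    then have "v = \<zero>\<^bsub>power_module R n\<^esub>"
      using assms(1) by (intro ext) (auto simp: func_space_def PiE_def extensional_def restrict_def)
    then show False using assms(2) by simp
  qed
  then show ?thesis
    by (auto simp: hamming_weight_def card_gt_0_iff)
qed

lemma hamming_weight_le_if_prefix_zero:
  assumes "\<And>i. i < k \<Longrightarrow> v i = \<zero>\<^bsub>R\<^esub>"
  shows "hamming_weight R n v \<le> n - k"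
proof -
  have "{i. i < n \<and> v i \<noteq> \<zero>\<^bsub>R\<^esub>} \<subseteq> {k..<n}"
    using assms by (auto simp flip: not_less)
  then have "card {i. i < n \<and> v i \<noteq> \<zero>\<^bsub>R\<^esub>} \<le> card {k..<n}"
    by (intro card_mono) simp_all
  then show ?thesis
    by (simp add: hamming_weight_def)
qed

lemma hamming_weight_le: "hamming_weight R n v \<le> n"
  using hamming_weight_le_if_prefix_zero[of 0 v R n] by simp

lemma (in cring) min_distance_bounds:
  assumes C: "is_code R n C" and ne: "C \<noteq> {\<zero>\<^bsub>power_module R n\<^esub>}"
  shows "0 < min_distance R n C" and "min_distance R n C \<le> n"
    and "\<And>v. v \<in> C \<Longrightarrow> v \<noteq> \<zero>\<^bsub>power_module R n\<^esub> \<Longrightarrow> min_distance R n C \<le> hamming_weight R n v"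
proof -
  let ?W = "hamming_weight R n ` (C - {\<zero>\<^bsub>power_module R n\<^esub>})"
  have fin: "finite ?W"
    using hamming_weight_le by (intro finite_subset[of ?W "{..n}"]) fastforce+
  have "?W \<noteq> {}"
    using ne submodule.zero_closed[OF C] by auto
  then have "min_distance R n C \<in> ?W"
    unfolding min_distance_def by (rule Min_in[OF fin])
  then show "0 < min_distance R n C" "min_distance R n C \<le> n"
    using hamming_weight_pos hamming_weight_le submodule.subset[OF C] by fastforce+
  show "min_distance R n C \<le> hamming_weight R n v"
    if "v \<in> C" "v \<noteq> \<zero>\<^bsub>power_module R n\<^esub>" for v
    unfolding min_distance_def using fin that by (intro Min_le imageI DiffI) simp_all
qed

text \<open>If \<open>b = 0\<close>, the quotient is \<open>0\<close> by convention, and the bound is just \<open>d \<le> n + 1\<close>.\<close>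

lemma singleton_bound_of_product_bound:
  fixes d n a b :: nat
  assumes "d \<le> n" and "a \<le> (n + 1 - d) * b"
  shows "real d \<le> real n - real a / real b + 1"
proof (cases "b = 0")
  case False
  have "real a \<le> real (n + 1 - d) * real b"
    using assms(2) by (metis of_nat_le_iff of_nat_mult)
  then have "real a / real b \<le> real (n + 1 - d)"
    using False by (simp add: divide_le_eq)
  then show ?thesis
    using assms(1) by (simp add: of_nat_diff)
qed (use assms in simp)

theorem theorem2:
  fixes R :: "('a, 'b) ring_scheme" and \<mm> :: "'a set"
    and n :: nat and C :: "(nat \<Rightarrow> 'a) set"
  assumes "local_artinian_ring \<mm> R"
    and "n \<ge> 1"
    and "is_code R n C"
    and "C \<noteq> {\<zero>\<^bsub>power_module R n\<^esub>}"
  shows "real (min_distance R n C) \<le> real n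
            - real (the_enat (module_length R (code_as_module R n C)))
                / real (the_enat (module_length R (self_module R))) + 1
       \<and> real (min_distance R n C) \<le> real n
            - real (module_type \<mm> R (code_as_module R n C))
                / real (module_type \<mm> R (self_module R)) + 1"
proof -
  interpret local_artinian_ring \<mm> R by fact
  interpret S: module R "self_module R" by (rule module_self_module)
  interpret F: module R "power_module R n" by (rule func_space_is_module)
  note C = assms(3)
  interpret C: module R "code_as_module R n C"
    by (rule F.submodule_is_module) fact
  note max = is_maximalideal
  define d where "d = min_distance R n C"
  define k where "k = n + 1 - d"
  have d: "0 < d" "d \<le> n" "\<And>v. v \<in> C \<Longrightarrow> v \<noteq> \<zero>\<^bsub>power_module R n\<^esub> \<Longrightarrow> d \<le> hamming_weight R n v"
    using min_distance_bounds[OF assms(3,4)] by (auto simp: d_def)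
  have k: "k \<le> n"
    using d by (simp add: k_def)
  have inj: "v = \<zero>\<^bsub>power_module R n\<^esub>" if "v \<in> C" "\<And>i. i < k \<Longrightarrow> v i = \<zero>\<^bsub>R\<^esub>" for v
  proof (rule ccontr)
    assume "v \<noteq> \<zero>\<^bsub>power_module R n\<^esub>"
    then have "d \<le> n - k"
      using d(3)[OF that(1)] hamming_weight_le_if_prefix_zero[of k v R n] that(2) by fastforce
    then show False
      using d by (simp add: k_def)
  qed
  have in_R: "v i \<in> carrier R" if "v \<in> C" "i < k" for v i
  proof -
    have "v \<in> {..<n} \<rightarrow>\<^sub>E carrier R"
      using that(1) submodule.subset[OF C] by (auto simp: func_space_def)
    then show ?thesis
      using PiE_mem[of v "{..<n}" "\<lambda>_. carrier R" i] that(2) k by simp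
  qed
  obtain L\<^sub>0 where L\<^sub>0: "length_at_most R (self_module R) (carrier R) L\<^sub>0"
    using finite_length by blast
  have S_carrier: "carrier (self_module R) = carrier R"
    by (simp add: self_module_def)

  have "the_enat (module_length R (code_as_module R n C)) \<le>
    k * the_enat (module_length R (self_module R))"
  proof -
    have "module_length R (self_module R) \<le> enat L\<^sub>0"
      using L\<^sub>0 by (intro module_length_le_if_length_at_most) (simp add: S_carrier)
    then obtain L where L: "module_length R (self_module R) = enat L"
      by (cases "module_length R (self_module R)") auto
    have len: "length_at_most R (self_module R) (carrier R) L"
      using S.length_at_most_if_module_length_le[of L] L by (simp add: S_carrier)
    have "length_at_most R (power_module R n) C (k * L)"
    proof (rule length_at_most_of_information_set[OF C k])
      show "v = \<zero>\<^bsub>power_module R n\<^esub>" if "v \<in> C" "\<And>i. i < k \<Longrightarrow> v i = \<zero>\<^bsub>R\<^esub>" for v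
        using that by (rule inj)
    qed (fact in_R, fact len)
    then have "module_length R (code_as_module R n C) \<le> enat (k * L)"
      using F.length_at_most_restrict_carrier[OF C]
      by (intro module_length_le_if_length_at_most) simp
    then show ?thesis
      unfolding L by (cases "module_length R (code_as_module R n C)") auto
  qed
  moreover have "module_type \<mm> R (code_as_module R n C) \<le> k * module_type \<mm> R (self_module R)"
  proof -
    define t where "t = module_type \<mm> R (self_module R)"
    have "length_at_most R (self_module R) (socle \<mm> (self_module R)) L\<^sub>0"
      by (rule length_at_most_mono[OF L\<^sub>0]) (auto simp: socle_def S_carrier)
    then have t: "length_at_most R (self_module R) (socle \<mm> (self_module R)) t"
      using S.dim_socle_space_le(1)[OF max] S.length_at_most_dim_socle_space[OF max]
      by (simp add: t_def module_type_def)
    define D where "D = socle \<mm> (code_as_module R n C)"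
    have D_sub: "submodule R D (power_module R n)" "D \<subseteq> C"
      using C.submodule_socle[OF is_ideal] F.submodule_restrict_carrier[OF C]
      by (auto simp: D_def)
    have coord: "v i \<in> socle \<mm> (self_module R)" if v: "v \<in> D" and i: "i < k" for v i
    proof -
      interpret h: mod_hom R "power_module R n" "self_module R" "\<lambda>v. v i"
        using i k by (intro mod_hom_coordinate) simp
      have vc: "v \<in> carrier (power_module R n)"
        using v D_sub submodule.subset by blast
      have "r \<odot>\<^bsub>self_module R\<^esub> v i = \<zero>\<^bsub>self_module R\<^esub>" if r: "r \<in> \<mm>" for r
      proof -
        have "r \<odot>\<^bsub>power_module R n\<^esub> v = \<zero>\<^bsub>power_module R n\<^esub>"
          using v r by (simp add: D_def socle_def)
        then show ?thesis
          using h.f_smult[OF a_Hcarr[OF r] vc] h.f0_is_0 by simp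
      qed
      then show ?thesis
        using h.f_im[OF vc] by (simp add: socle_def)
    qed
    have "length_at_most R (power_module R n) D (k * t)"
    proof (rule length_at_most_of_information_set[OF D_sub(1) k])
      show "v = \<zero>\<^bsub>power_module R n\<^esub>" if "v \<in> D" "\<And>i. i < k \<Longrightarrow> v i = \<zero>\<^bsub>R\<^esub>" for v
        using that D_sub(2) by (intro inj) auto
    qed (fact coord, fact t)
    then have "length_at_most R (code_as_module R n C) D (k * t)"
      by (rule F.length_at_most_restrict_carrier[OF C])
    then show ?thesis
      using C.dim_socle_space_le(2)[OF max] by (simp add: D_def t_def module_type_def)
  qed
  ultimately show ?thesis
    using d(2) singleton_bound_of_product_bound[of d n] unfolding k_def d_def by blast
qed

end
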